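(* Let $X$ be an ordered Banach space and let $C' \subseteq X'_+$ be a set of positive functionals with the following properties: (1) $C'$ is weak*-compact. (2) $C'$ determines positivity in the following sense: if $x \in X$ and $\langle c', x\rangle \ge 0$ for all $c' \in C'$, then $x \in X_+$. (3) $C'$ is almost norming on $X_+$ in the following sense: there is a number $\delta > 0$ such that $\sup_{c' \in C'} \langle c', x\rangle \ge \delta \|x\|$ for every $x \in X_+$. If $(x_j)_{j \in J}$ is an increasing net in $X$ and $x_0 \in X$ is such that $\langle c', x_j\rangle \to \langle c', x_0\rangle$ for each $c' \in C'$, then $x_j \to x_0$ in norm.
   Context: An ordered Banach space is a real Banach space $X$ together with a norm closed cone $X_+$, i.e. a norm closed non-empty subset $X_+ \subseteq X$ with $\alpha X_+ + \beta X_+ \subseteq X_+$ for all scalars $\alpha,\beta \in [0,\infty)$ and $X_+ \cap (-X_+) = \{0\}$. The partial order is given by $x \le y$ iff $y - x \in X_+$. $X'$ is the norm dual, $\langle x',x\rangle := x'(x)$, and $X'_+ := \{x' \in X' : \langle x',x\rangle \ge 0 \text{ for all } x \in X_+\}$ is the set of positive functionals. A net $(x_j)_{j\in J}$ (with $J$ a directed set) is increasing if $x_j \le x_k$ whenever $j \le k$. *)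

theory Defs
  imports "HOL-Analysis.Analysis"
begin

definition ordered_banach_cone :: "'a::banach set \<Rightarrow> bool" where
  "ordered_banach_cone K \<longleftrightarrow>
     closed K \<and> K \<noteq> {} \<and>
     (\<forall>\<alpha>\<ge>0. \<forall>\<beta>\<ge>0. \<forall>x\<in>K. \<forall>y\<in>K. \<alpha> *\<^sub>R x + \<beta> *\<^sub>R y \<in> K) \<and>
     K \<inter> uminus ` K = {0}"

definition cone_le :: "'a::banach set \<Rightarrow> 'a \<Rightarrow> 'a \<Rightarrow> bool" where
  "cone_le K x y \<longleftrightarrow> y - x \<in> K"

definition positive_functionals :: "'a::banach set \<Rightarrow> ('a \<Rightarrow>\<^sub>L real) set" where
  "positive_functionals K = {f. \<forall>x\<in>K. 0 \<le> blinfun_apply f x}"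

(* On the norm dual, the strong operator topology (the initial topology with
   respect to all evaluations f \<mapsto> f x) is the weak* topology. *)
definition weak_star_topology :: "('a::banach \<Rightarrow>\<^sub>L real) topology" where
  "weak_star_topology = strong_operator_topology"

definition determines_positivity :: "'a::banach set \<Rightarrow> ('a \<Rightarrow>\<^sub>L real) set \<Rightarrow> bool" where
  "determines_positivity K C \<longleftrightarrow> (\<forall>x. (\<forall>f\<in>C. 0 \<le> blinfun_apply f x) \<longrightarrow> x \<in> K)"

(* The supremum is taken in the extended reals, where it always exists; in particular
   the supremum over the empty set is -\<infinity>. *)
definition almost_norming_on :: "'a::banach set \<Rightarrow> ('a \<Rightarrow>\<^sub>L real) set \<Rightarrow> bool" where
  "almost_norming_on K C \<longleftrightarrow>
     (\<exists>\<delta>::real. \<delta> > 0 \<and>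
        (\<forall>x\<in>K. ereal (\<delta> * norm x) \<le> (SUP f\<in>C. ereal (blinfun_apply f x))))"

(* A directed set is a non-empty carrier J with a preorder r, where (j, k) \<in> r reads
   j \<le> k; antisymmetry is not required. *)
definition directed_set :: "'j set \<Rightarrow> ('j \<times> 'j) set \<Rightarrow> bool" where
  "directed_set J r \<longleftrightarrow>
     J \<noteq> {} \<and> preorder_on J r \<and> (\<forall>i\<in>J. \<forall>j\<in>J. \<exists>k\<in>J. (i, k) \<in> r \<and> (j, k) \<in> r)"

(* The filter of tails: convergence of a net indexed by (J, r) is convergence along it. *)
definition net_filter :: "'j set \<Rightarrow> ('j \<times> 'j) set \<Rightarrow> 'j filter" where
  "net_filter J r = (INF j\<in>J. principal {k \<in> J. (j, k) \<in> r})"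

lemma eventually_net_filter:
  assumes "directed_set J r"
  shows "eventually P (net_filter J r) \<longleftrightarrow> (\<exists>j\<in>J. \<forall>k\<in>J. (j, k) \<in> r \<longrightarrow> P k)"
proof -
  have ne: "J \<noteq> {}" and tr: "trans r"
    and dir: "\<And>i j. i \<in> J \<Longrightarrow> j \<in> J \<Longrightarrow> \<exists>k\<in>J. (i, k) \<in> r \<and> (j, k) \<in> r"
    using assms by (auto simp: directed_set_def preorder_on_def)
  have "\<exists>k\<in>J. principal {l \<in> J. (k, l) \<in> r}
          \<le> inf (principal {l \<in> J. (i, l) \<in> r}) (principal {l \<in> J. (j, l) \<in> r})"
    if "i \<in> J" "j \<in> J" for i j
    using dir[OF that] transD[OF tr] by (simp add: subset_iff) blast
  then have "eventually P (net_filter J r) \<longleftrightarrow>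
      (\<exists>j\<in>J. eventually P (principal {k \<in> J. (j, k) \<in> r}))"
    unfolding net_filter_def by (intro eventually_INF_base ne)
  then show ?thesis by (auto simp: eventually_principal)
qed

definition increasing_net ::
  "'a::banach set \<Rightarrow> 'j set \<Rightarrow> ('j \<times> 'j) set \<Rightarrow> ('j \<Rightarrow> 'a) \<Rightarrow> bool" where
  "increasing_net K J r x \<longleftrightarrow> (\<forall>j\<in>J. \<forall>k\<in>J. (j, k) \<in> r \<longrightarrow> cone_le K (x j) (x k))"

end

theory Submission
  imports Defs
begin

text \<open>
  This is Dini's theorem for the functions \<open>f \<mapsto> f (x0 - x j)\<close> on \<open>C\<close>. For \<open>f \<in> C\<close> the net
  \<open>f (x j)\<close> increases to \<open>f x0\<close>, so \<open>f (x0 - x j) \<ge> 0\<close>; as \<open>C\<close> determines positivity,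
  \<open>x0 - x j\<close> lies in the cone. Weak* continuity of evaluations makes the sets
  \<open>{f. f (x0 - x j) < e}\<close> weak* open. They cover \<open>C\<close> and increase with \<open>j\<close>, so by compactness and
  directedness a single one contains \<open>C\<close>. Hence \<open>f (x0 - x j) < e\<close> eventually holds uniformly in
  \<open>f \<in> C\<close>, and the almost norming condition, applicable because \<open>x0 - x j\<close> is in the cone, turns
  this uniform smallness into smallness of the norm.
\<close>

lemma directed_set_finite_upper_bound:
  assumes "directed_set J r" "finite F" "F \<subseteq> J"
  shows "\<exists>k\<in>J. \<forall>i\<in>F. (i, k) \<in> r"
  using assms(2,3)
proof (induction F rule: finite_induct)
  case empty
  then show ?case using assms(1) by (auto simp: directed_set_def)
next
  case (insert i F)
  then obtain k where k: "k \<in> J" "\<forall>i\<in>F. (i, k) \<in> r" by auto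
  obtain l where l: "l \<in> J" "(i, l) \<in> r" "(k, l) \<in> r"
    using assms(1) insert.prems k(1) unfolding directed_set_def by blast
  have "trans r" using assms(1) by (simp add: directed_set_def preorder_on_def)
  then have "\<forall>i'\<in>insert i F. (i', l) \<in> r" using k l by (auto dest: transD)
  then show ?case using l(1) by blast
qed

lemma net_filter_neq_bot:
  assumes "directed_set J r"
  shows "net_filter J r \<noteq> bot"
proof -
  have "refl_on J r" using assms by (simp add: directed_set_def preorder_on_def)
  then show ?thesis
    unfolding trivial_limit_def eventually_net_filter[OF assms] by (auto dest: refl_onD)
qed

lemma increasing_net_le_limit:
  fixes a :: "'j \<Rightarrow> real"
  assumes dir: "directed_set J r"
    and mono: "\<And>j k. j \<in> J \<Longrightarrow> k \<in> J \<Longrightarrow> (j, k) \<in> r \<Longrightarrow> a j \<le> a k"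
    and lim: "(a \<longlongrightarrow> l) (net_filter J r)"
    and j: "j \<in> J"
  shows "a j \<le> l"
proof (rule tendsto_lowerbound[OF lim _ net_filter_neq_bot[OF dir]])
  show "\<forall>\<^sub>F k in net_filter J r. a j \<le> a k"
    unfolding eventually_net_filter[OF dir] using mono j by blast
qed

lemma openin_weak_star_evaluation_less:
  "openin weak_star_topology {f. blinfun_apply f y < (e::real)}"
proof -
  have "openin strong_operator_topology
      {f \<in> topspace strong_operator_topology. blinfun_apply f y \<in> {..<e}}"
    by (rule openin_continuous_map_preimage[OF strong_operator_topology_continuous_evaluation])
      auto
  then show ?thesis by (simp add: weak_star_topology_def strong_operator_topology_topspace)
qed

text \<open>Compactness enters only here: for a net whose evaluations decrease at every point of a
  weak* compact set, falling below \<open>e\<close> pointwise implies eventually being below \<open>e\<close> uniformly.\<close>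

lemma weak_star_dini:
  fixes y :: "'j \<Rightarrow> 'a::banach"
  assumes dir: "directed_set J r"
    and comp: "compactin weak_star_topology C"
    and antimono: "\<And>f j k. f \<in> C \<Longrightarrow> j \<in> J \<Longrightarrow> k \<in> J \<Longrightarrow> (j, k) \<in> r \<Longrightarrow>
                     blinfun_apply f (y k) \<le> blinfun_apply f (y j)"
    and small: "\<And>f. f \<in> C \<Longrightarrow> \<exists>j\<in>J. blinfun_apply f (y j) < e"
  shows "\<exists>j\<in>J. \<forall>k\<in>J. (j, k) \<in> r \<longrightarrow> (\<forall>f\<in>C. blinfun_apply f (y k) < e)"
proof -
  define U where "U j = {f. blinfun_apply f (y j) < e}" for j
  have "\<And>V. V \<in> U ` J \<Longrightarrow> openin weak_star_topology V"
    using openin_weak_star_evaluation_less by (auto simp: U_def)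
  moreover have "C \<subseteq> \<Union> (U ` J)"
    using small by (fastforce simp: U_def)
  ultimately obtain \<V> where "finite \<V>" "\<V> \<subseteq> U ` J" and cov: "C \<subseteq> \<Union> \<V>"
    using compactinD[OF comp, of "U ` J"] by blast
  then obtain F where F: "finite F" "F \<subseteq> J" "\<V> = U ` F"
    by (meson finite_subset_image)
  obtain j where j: "j \<in> J" "\<forall>i\<in>F. (i, j) \<in> r"
    using directed_set_finite_upper_bound[OF dir F(1,2)] by blast
  have "blinfun_apply f (y k) < e" if k: "k \<in> J" "(j, k) \<in> r" and f: "f \<in> C" for k f
  proof -
    obtain i where i: "i \<in> F" "blinfun_apply f (y i) < e"
      using cov F(3) f by (auto simp: U_def)
    have "trans r" using dir by (simp add: directed_set_def preorder_on_def)
    then have "(i, k) \<in> r" using j(2) i(1) k(2) by (blast dest: transD)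
    then show ?thesis using antimono[of f i k] i F(2) k f by force
  qed
  then show ?thesis using j(1) by blast
qed

theorem theorem4p1:
  fixes K :: "'a::banach set"
    and C :: "('a \<Rightarrow>\<^sub>L real) set"
    and J :: "'j set" and r :: "('j \<times> 'j) set"
    and x :: "'j \<Rightarrow> 'a" and x0 :: 'a
  assumes "ordered_banach_cone K"
    and "C \<subseteq> positive_functionals K"
    and "compactin weak_star_topology C"
    and "determines_positivity K C"
    and "almost_norming_on K C"
    and "directed_set J r"
    and "increasing_net K J r x"
    and "\<And>f. f \<in> C \<Longrightarrow> ((\<lambda>j. blinfun_apply f (x j)) \<longlongrightarrow> blinfun_apply f x0) (net_filter J r)"
  shows "(x \<longlongrightarrow> x0) (net_filter J r)"
proof (rule tendstoI)
  fix \<epsilon> :: real assume \<epsilon>: "\<epsilon> > 0"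
  note dir = assms(6) and lim = assms(8)
  have mono: "blinfun_apply f (x j) \<le> blinfun_apply f (x k)"
    if "f \<in> C" "j \<in> J" "k \<in> J" "(j, k) \<in> r" for f j k
  proof -
    have "x k - x j \<in> K"
      using assms(7) that by (auto simp: increasing_net_def cone_le_def)
    then have "0 \<le> blinfun_apply f (x k - x j)"
      using assms(2) that(1) by (auto simp: positive_functionals_def)
    then show ?thesis by (simp add: blinfun.diff_right)
  qed
  have inK: "x0 - x j \<in> K" if "j \<in> J" for j
  proof -
    have "blinfun_apply f (x j) \<le> blinfun_apply f x0" if "f \<in> C" for f
      using increasing_net_le_limit[OF dir _ lim[OF that] \<open>j \<in> J\<close>] mono[OF that] by blast
    then show ?thesis
      using assms(4) by (simp add: determines_positivity_def blinfun.diff_right)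
  qed
  obtain \<delta> where \<delta>: "\<delta> > 0"
    and norming: "\<And>z. z \<in> K \<Longrightarrow> ereal (\<delta> * norm z) \<le> (SUP f\<in>C. ereal (blinfun_apply f z))"
    using assms(5) by (auto simp: almost_norming_on_def)
  \<comment> \<open>The supremum gives only a weak inequality, hence the factor one half.\<close>
  define e where "e = \<delta> * \<epsilon> / 2"
  have e: "e > 0" using \<delta> \<epsilon> by (simp add: e_def)
  have "\<exists>j\<in>J. \<forall>k\<in>J. (j, k) \<in> r \<longrightarrow> (\<forall>f\<in>C. blinfun_apply f (x0 - x k) < e)"
  proof (rule weak_star_dini[OF dir assms(3)])
    fix f j k assume "f \<in> C" "j \<in> J" "k \<in> J" "(j, k) \<in> r"
    then show "blinfun_apply f (x0 - x k) \<le> blinfun_apply f (x0 - x j)"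
      using mono by (simp add: blinfun.diff_right)
  next
    fix f assume "f \<in> C"
    from order_tendstoD(1)[OF lim[OF this], of "blinfun_apply f x0 - e"] e
    have "\<forall>\<^sub>F j in net_filter J r. blinfun_apply f x0 - e < blinfun_apply f (x j)" by simp
    then obtain j where j: "j \<in> J"
      and *: "\<And>k. k \<in> J \<Longrightarrow> (j, k) \<in> r \<Longrightarrow> blinfun_apply f x0 - e < blinfun_apply f (x k)"
      unfolding eventually_net_filter[OF dir] by blast
    have "(j, j) \<in> r"
      using dir j by (auto simp: directed_set_def preorder_on_def dest: refl_onD)
    with *[OF j] j show "\<exists>j\<in>J. blinfun_apply f (x0 - x j) < e"
      by (auto simp: blinfun.diff_right algebra_simps)
  qed
  then obtain j where j: "j \<in> J"
    and unif: "\<And>k f. k \<in> J \<Longrightarrow> (j, k) \<in> r \<Longrightarrow> f \<in> C \<Longrightarrow> blinfun_apply f (x0 - x k) < e"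
    by blast
  have "dist (x k) x0 < \<epsilon>" if k: "k \<in> J" "(j, k) \<in> r" for k
  proof -
    have "(SUP f\<in>C. ereal (blinfun_apply f (x0 - x k))) \<le> ereal e"
      using unif[OF k] by (intro SUP_least) (simp add: less_imp_le)
    with norming[OF inK[OF k(1)]] have "ereal (\<delta> * norm (x0 - x k)) \<le> ereal e"
      by (rule order_trans)
    then have "\<delta> * norm (x0 - x k) \<le> \<delta> * (\<epsilon> / 2)" by (simp add: e_def)
    then have "norm (x0 - x k) \<le> \<epsilon> / 2" using \<delta> by (simp only: mult_le_cancel_left_pos)
    then show ?thesis using \<epsilon> by (simp add: dist_norm norm_minus_commute)
  qed
  then show "\<forall>\<^sub>F k in net_filter J r. dist (x k) x0 < \<epsilon>"
    unfolding eventually_net_filter[OF dir] using j by blast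
qed

end
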